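(* For $n\in\mathbb N$ and $\delta\in\{0,1\}$, the following holds in $\mathbb Q[X,Z]$: $$\sum_{w\in B_n}(-1)^{\mathrm{neg}(w)}X^{-(2(\ell-\sigma)+(2\delta-1)\mathrm{neg}-(2\delta-3)\mathrm{rmaj}-(2n+\delta)\mathrm{des})(w)}Z^{\mathrm{des}(w)}=\Bigl(1-X^{\binom{2n+\delta-1}2}Z\Bigr)\prod_{i=2}^n\Bigl(1-X^{\binom{2n+\delta}2-\binom{2i+\delta}2+2i+\delta}Z\Bigr).$$
   Context: $B_n$ is the hyperoctahedral group of all bijections $w$ of $\{-n,\dots,-1,0,1,\dots,n\}$ with $w(-i)=-w(i)$ for all $i$ (so $w(0)=0$). Write $w=[w(1),\dots,w(n)]$. $\ell$ is the Coxeter length with respect to the generators $s_0=[-1,2,\dots,n]$ and $s_i=[1,\dots,i-1,i+1,i,i+2,\dots,n]$, $1\le i\le n-1$. Statistics on $B_n$: $\mathrm{neg}(w)=|\{i\in\{1,\dots,n\}: w(i)<0\}|$; $D(w)=\{i\in\{0,\dots,n-1\}: w(i)>w(i+1)\}$; $\mathrm{des}(w)=|D(w)|$; $\sigma(w)=\sum_{i\in D(w)}(n^2-i^2)$; $\mathrm{rmaj}(w)=\sum_{i\in D(w)}(n-i)$. A linear combination of statistics applied to $w$ means the linear combination of their values at $w$. *)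

theory Defs
  imports
    "HOL-Combinatorics.Permutations"
    "HOL-Computational_Algebra.Polynomial"
begin

(* A bijection of {-n,...,n} is represented by its extension to all integers by the identity,
   so that composition of functions is the group operation. *)
definition hyperoct :: "nat \<Rightarrow> (int \<Rightarrow> int) set" where
  "hyperoct n = {w. w permutes {- int n..int n} \<and> (\<forall>i \<in> {- int n..int n}. w (- i) = - w i)}"

(* In one-line notation: s_0 = [-1,2,...,n] and s_i exchanges the entries i and i+1;
   oddness forces the second transposition. *)
definition cox_gen :: "nat \<Rightarrow> int \<Rightarrow> int" where
  "cox_gen i =
     (if i = 0 then transpose (- 1) 1
      else transpose (int i) (int i + 1) \<circ> transpose (- int i) (- (int i + 1)))"

definition word_prod :: "nat list \<Rightarrow> int \<Rightarrow> int" where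
  "word_prod is = foldr (\<lambda>i w. cox_gen i \<circ> w) is id"

definition cox_length :: "nat \<Rightarrow> (int \<Rightarrow> int) \<Rightarrow> nat" where
  "cox_length n w = (LEAST k. \<exists>is. length is = k \<and> set is \<subseteq> {..<n} \<and> word_prod is = w)"

definition neg :: "nat \<Rightarrow> (int \<Rightarrow> int) \<Rightarrow> nat" where
  "neg n w = card {i \<in> {1..n}. w (int i) < 0}"

definition Des :: "nat \<Rightarrow> (int \<Rightarrow> int) \<Rightarrow> nat set" where
  "Des n w = {i \<in> {..<n}. w (int i) > w (int i + 1)}"

definition des :: "nat \<Rightarrow> (int \<Rightarrow> int) \<Rightarrow> nat" where
  "des n w = card (Des n w)"

definition sigma :: "nat \<Rightarrow> (int \<Rightarrow> int) \<Rightarrow> int" where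
  "sigma n w = (\<Sum>i\<in>Des n w. (int n)\<^sup>2 - (int i)\<^sup>2)"

definition rmaj :: "nat \<Rightarrow> (int \<Rightarrow> int) \<Rightarrow> int" where
  "rmaj n w = (\<Sum>i\<in>Des n w. int n - int i)"

definition X_exponent :: "nat \<Rightarrow> nat \<Rightarrow> (int \<Rightarrow> int) \<Rightarrow> int" where
  "X_exponent n \<delta> w =
     - (2 * (int (cox_length n w) - sigma n w)
        + (2 * int \<delta> - 1) * int (neg n w)
        - (2 * int \<delta> - 3) * rmaj n w
        - (2 * int n + int \<delta>) * int (des n w))"

(* The ring Q[X,Z] is realised as Q[X][Z]. *)
abbreviation X :: "rat poly poly" where
  "X \<equiv> [:[:0, 1:]:]"

abbreviation Z :: "rat poly poly" where
  "Z \<equiv> [:0, 1:]"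

end

(*
  Let l(w) = invs n w be the usual inversion formula for the length and put p = X^(-2),
  c = X^(1 - 2 delta) and y_i = y c^i p^(i (i - 1)), where y = X^(binom(2 n + delta, 2) + delta) Z.
  The sum becomes

    G_n = sum_w (-c)^neg(w) p^l(w) prod_{i in D(w)} y_i,

  and the claim is (1 - y_0) (1 - y_1) G_n = (1 - y c p^n) prod_{i <= n} (1 - y_i).  Since y_i does not
  depend on n (for fixed y), induction on n applies.  Let S_m be the same sum restricted to the w
  without descents at positions >= m, so that S_0 = 1 and S_n = G_n.  A w whose descents at positions
  > m are excluded, while a descent at m is free, is a pair of an element of B_m and an ascending
  tail, whence

    S_(m+1) = (1 - y_m) S_m + y_m F(n, m) G_m,
    F(n, m) = qbin p n m * prod_{m < i <= n} (1 - c p^i).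

  Solving this recursion leaves two q-binomial identities, the coefficients of y and y^2 in

    (1 - y_0) (1 - y_1) + sum_{j <= n} F(n, j) y_j (1 - y c p^j) = 1 - y c p^n.

  Negative powers of X are avoided by evaluating at rational numbers x, z > 1.
*)

theory Submission
  imports Defs
begin

section \<open>q-binomial coefficients\<close>

text \<open>Recursive and not a quotient, so that \<open>p\<close> may lie in any commutative
  ring.\<close>

fun qbin :: "'a::comm_ring_1 \<Rightarrow> nat \<Rightarrow> nat \<Rightarrow> 'a" where
  "qbin p n 0 = 1"
| "qbin p 0 (Suc k) = 0"
| "qbin p (Suc n) (Suc k) = qbin p n k + p ^ Suc k * qbin p n (Suc k)"

lemma qbin_eq_0: "n < k \<Longrightarrow> qbin p n k = 0"
  by (induction p n k rule: qbin.induct) auto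

lemma qbin_self [simp]: "qbin p n n = 1"
  by (induction n) (auto simp: qbin_eq_0)

text \<open>The other q-Pascal rule. Expanding by the defining rule and then by the induction
  hypothesis gives four products, which the defining rule regroups.\<close>

lemma qbin_Suc_Suc':
  "k \<le> n \<Longrightarrow> qbin p (Suc n) (Suc k) = p ^ (n - k) * qbin p n k + qbin p n (Suc k)"
proof (induction n arbitrary: k)
  case 0
  then show ?case by simp
next
  case (Suc n)
  show ?case
  proof (cases k)
    case 0
    have "qbin p (Suc n) 1 = p ^ n + qbin p n 1"
      using Suc.IH[of 0] by simp
    then show ?thesis
      by (simp add: 0 algebra_simps)
  next
    case k: (Suc k')
    show ?thesis
    proof (cases "k \<le> n")
      case True
      have e: "Suc n - k = n - k'" "p ^ Suc k * p ^ (n - k) = p ^ (n - k') * p ^ k"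
        using True k by (simp_all add: Suc_diff_le flip: power_Suc power_add)
      have "qbin p (Suc (Suc n)) (Suc k) = qbin p (Suc n) k + p ^ Suc k * qbin p (Suc n) (Suc k)"
        by simp
      also have "\<dots> = p ^ (n - k') * qbin p n k' + qbin p n k +
          (p ^ Suc k * p ^ (n - k)) * qbin p n k + p ^ Suc k * qbin p n (Suc k)"
        using Suc.IH[of k] Suc.IH[of k'] True k by (simp only: distrib_left mult.assoc) simp
      also have "\<dots> = p ^ (Suc n - k) * (qbin p n k' + p ^ k * qbin p n k) +
          (qbin p n k + p ^ Suc k * qbin p n (Suc k))"
        unfolding e by (simp only: distrib_left mult.assoc add_ac)
      also have "\<dots> = p ^ (Suc n - k) * qbin p (Suc n) k + qbin p (Suc n) (Suc k)"
        by (simp add: k)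
      finally show ?thesis .
    next
      case False
      then have "k = Suc n" using Suc.prems by simp
      then show ?thesis by (simp add: qbin_eq_0)
    qed
  qed
qed

text \<open>The Pochhammer symbol \<open>(p; p)_n\<close>, that is, the q-factorial without division
  by powers of \<open>1 - p\<close>.\<close>

definition qfact :: "'a::comm_ring_1 \<Rightarrow> nat \<Rightarrow> 'a" where
  "qfact p n = (\<Prod>i=1..n. 1 - p ^ i)"

lemma qfact_Suc: "qfact p (Suc n) = qfact p n * (1 - p ^ Suc n)"
  by (simp add: qfact_def)

text \<open>The quotient formula with cleared denominators. The two Pascal terms contribute
  \<open>1 - p ^ k\<close> and \<open>p ^ k * (1 - p ^ Suc (n - k))\<close>, which add up to
  \<open>1 - p ^ Suc n\<close>.\<close>

lemma qbin_qfact: "k \<le> n \<Longrightarrow> qbin p n k * (qfact p k * qfact p (n - k)) = qfact p n"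
proof (induction n arbitrary: k)
  case 0
  then show ?case by (simp add: qfact_def)
next
  case (Suc n)
  show ?case
  proof (cases k)
    case 0
    then show ?thesis by (simp add: qfact_def)
  next
    case k: (Suc k')
    show ?thesis
    proof (cases "k \<le> n")
      case True
      have 1: "n - k' = Suc (n - k)" using True k by simp
      have 2: "qbin p n k' * (qfact p k' * qfact p (n - k')) = qfact p n"
        using Suc.IH[of k'] True k by simp
      have 3: "qbin p n k * (qfact p k * qfact p (n - k)) = qfact p n"
        using Suc.IH[of k] True by simp
      have "qbin p (Suc n) k * (qfact p k * qfact p (Suc n - k)) =
        (qbin p n k' * (qfact p k' * qfact p (n - k'))) * (1 - p ^ k) +
        p ^ k * (qbin p n k * (qfact p k * qfact p (n - k))) * (1 - p ^ Suc (n - k))"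
        using 1 by (simp add: k qfact_Suc algebra_simps)
      also have "\<dots> = qfact p n * (1 - p ^ k + p ^ k * (1 - p ^ Suc (n - k)))"
        unfolding 2 3 by (simp add: algebra_simps)
      also have "1 - p ^ k + p ^ k * (1 - p ^ Suc (n - k)) = 1 - p ^ (k + Suc (n - k))"
        unfolding power_add by (simp add: algebra_simps)
      also have "k + Suc (n - k) = Suc n" using True by simp
      finally show ?thesis by (simp add: qfact_Suc)
    next
      case False
      then have "k = Suc n" using Suc.prems by simp
      then show ?thesis by (simp only: qbin_self diff_self_eq_0) (simp add: qfact_def)
    qed
  qed
qed

text \<open>Times \<open>qfact p r * qfact p m * qfact p (d - r)\<close>, both sides are
  \<open>qfact p (m + d)\<close>; the assumption on \<open>p\<close> makes this factor
  nonzero.\<close>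

lemma qbin_trinomial:
  fixes p :: "'a::idom"
  assumes p: "\<And>i. 0 < i \<Longrightarrow> p ^ i \<noteq> 1" and r: "r \<le> d"
  shows "qbin p (m + r) r * qbin p (m + d) (m + r) = qbin p (m + d) m * qbin p d r"
proof -
  have nz: "qfact p k \<noteq> 0" for k
    using p by (auto simp: qfact_def)
  have "qbin p (m + r) r * qbin p (m + d) (m + r) * (qfact p r * qfact p m * qfact p (d - r)) =
      qbin p (m + d) (m + r) * (qbin p (m + r) r * (qfact p r * qfact p m) * qfact p (d - r))"
    by (simp add: algebra_simps)
  also have "\<dots> = qfact p (m + d)"
    using qbin_qfact[of r "m + r" p] qbin_qfact[of "m + r" "m + d" p] r by simp
  also have "\<dots> = qbin p (m + d) m * (qfact p m * (qbin p d r * (qfact p r * qfact p (d - r))))"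
    using qbin_qfact[of m "m + d" p] qbin_qfact[of r d p] r by simp
  finally show ?thesis
    using nz[of r] nz[of m] nz[of "d - r"] by (simp add: ac_simps)
qed

section \<open>The q-binomial theorem and q-binomial sums\<close>

lemma choose_two_0 [simp]: "0 choose 2 = 0"
  by (simp add: numeral_2_eq_2)

lemma choose_two_Suc: "Suc r choose 2 = (r choose 2) + r"
  by (simp add: numeral_2_eq_2)

text \<open>The q-binomial theorem: \<open>qbin_Suc_Suc'\<close> splits off the last factor
  \<open>1 + y * p ^ d\<close>.\<close>

lemma qbin_theorem:
  "(\<Sum>r\<le>d. qbin p d r * p ^ (r choose 2) * y ^ r) = (\<Prod>i<d. 1 + y * p ^ i)"
proof (induction d)
  case 0
  then show ?case by simp
next
  case (Suc d)
  let ?f = "\<lambda>d r. qbin p d r * p ^ (r choose 2) * y ^ r"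
  have step: "?f (Suc d) (Suc r) = y * p ^ d * ?f d r + ?f d (Suc r)" if "r \<le> d" for r
  proof -
    have "p ^ (d - r) * p ^ r = p ^ d"
      using that by (simp flip: power_add)
    moreover have "p ^ (d - r) * qbin p d r * (p ^ (r choose 2) * p ^ r) * y ^ Suc r =
        y * (p ^ (d - r) * p ^ r) * ?f d r"
      by (simp only: power_Suc mult_ac)
    ultimately have "p ^ (d - r) * qbin p d r * (p ^ (r choose 2) * p ^ r) * y ^ Suc r =
        y * p ^ d * ?f d r"
      by (simp only:)
    then show ?thesis
      unfolding qbin_Suc_Suc'[OF that] choose_two_Suc power_add by (simp only: distrib_right)
  qed
  have "(\<Sum>r\<le>Suc d. ?f (Suc d) r) = 1 + (\<Sum>r\<le>d. ?f (Suc d) (Suc r))"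
    by (subst sum.atMost_Suc_shift) simp
  also have "\<dots> = 1 + (\<Sum>r\<le>d. y * p ^ d * ?f d r + ?f d (Suc r))"
    using step by simp
  also have "\<dots> = y * p ^ d * (\<Sum>r\<le>d. ?f d r) + (1 + (\<Sum>r\<le>d. ?f d (Suc r)))"
    by (simp add: sum.distrib sum_distrib_left)
  also have "1 + (\<Sum>r\<le>d. ?f d (Suc r)) = (\<Sum>r\<le>Suc d. ?f d r)"
    by (subst sum.atMost_Suc_shift) simp
  also have "\<dots> = (\<Sum>r\<le>d. ?f d r)"
    by (simp add: qbin_eq_0)
  finally show ?case
    unfolding Suc.IH by (simp add: algebra_simps)
qed

lemma qbin_hockey_stick:
  "(\<Sum>b\<le>N. p ^ b * qbin p (b + d) b) = qbin p (N + Suc d) N"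
  by (induction N) (simp_all add: algebra_simps)

text \<open>In both sums below, one of the two Pascal rules relates the sum for \<open>(n + 1, c)\<close> to the one
  for \<open>(n, c p)\<close>.\<close>

lemma qbin_prod_sum_step:
  fixes f :: "nat \<Rightarrow> 'a::comm_ring_1"
  shows "(\<Sum>j\<le>Suc n. qbin p (Suc n) j * (\<Prod>i=Suc j..Suc n. 1 - c * p ^ i) * f j) =
    (\<Sum>j\<le>n. qbin p n j * (\<Prod>i=Suc j..n. 1 - c * p * p ^ i) *
      (p ^ j * (1 - c * p ^ Suc j) * f j + f (Suc j)))"
proof -
  define P where "P j = (\<Prod>i=Suc j..Suc n. 1 - c * p ^ i)" for j
  have P: "P (Suc j) = (\<Prod>i=Suc j..n. 1 - c * p * p ^ i)" for j
    unfolding P_def by (subst prod.shift_bounds_cl_Suc_ivl) (simp add: mult_ac)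
  have P': "P j = (1 - c * p ^ Suc j) * P (Suc j)" if "j \<le> n" for j
    using that unfolding P_def by (subst prod.atLeast_Suc_atMost) auto
  let ?A = "\<lambda>j. p ^ j * qbin p n j * P j * f j"
  have "(\<Sum>j\<le>Suc n. qbin p (Suc n) j * P j * f j) =
      P 0 * f 0 + (\<Sum>j\<le>n. qbin p (Suc n) (Suc j) * P (Suc j) * f (Suc j))"
    by (subst sum.atMost_Suc_shift) simp
  also have "\<dots> = (?A 0 + (\<Sum>j\<le>n. ?A (Suc j))) + (\<Sum>j\<le>n. qbin p n j * P (Suc j) * f (Suc j))"
    by (simp add: algebra_simps sum.distrib)
  also have "?A 0 + (\<Sum>j\<le>n. ?A (Suc j)) = (\<Sum>j\<le>Suc n. ?A j)"
    by (subst sum.atMost_Suc_shift) simp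
  also have "\<dots> = (\<Sum>j\<le>n. qbin p n j * P (Suc j) * (p ^ j * (1 - c * p ^ Suc j) * f j))"
    by (simp add: qbin_eq_0 P' mult_ac)
  finally show ?thesis
    unfolding P_def[symmetric] P[symmetric]
    by (simp add: sum.distrib distrib_left)
qed

text \<open>Since \<open>j * j + (2 * j + 1)\<close> is the next square,
  \<open>qbin_prod_sum_step\<close> merely replaces \<open>c\<close> by \<open>c * p\<close> in the
  summand. This settles the coefficient of \<open>y ^ 2\<close>.\<close>

lemma qbin_prod_sum_square:
  "(\<Sum>j\<le>n. qbin p n j * (\<Prod>i=Suc j..n. 1 - c * p ^ i) * (c ^ j * p ^ (j * j))) = 1"
proof (induction n arbitrary: c)
  case 0
  then show ?case by simp
next
  case (Suc n)
  have "p ^ j * (1 - c * p ^ Suc j) * (c ^ j * p ^ (j * j)) + c ^ Suc j * p ^ (Suc j * Suc j) =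
      (c * p) ^ j * p ^ (j * j)" for j
    by (simp add: algebra_simps power_add power_mult_distrib)
  then show ?case
    unfolding qbin_prod_sum_step using Suc.IH[of "c * p"] by simp
qed

text \<open>Here replacing \<open>c\<close> by \<open>c * p\<close> leaves a defect, namely
  \<open>c - c * p\<close> times the summand of \<open>qbin_prod_sum_square\<close> at
  \<open>c * p\<close>. This settles the coefficient of \<open>y\<close>.\<close>

lemma qbin_prod_sum_pronic:
  "(\<Sum>j\<le>n. qbin p n j * (\<Prod>i=Suc j..n. 1 - c * p ^ i) * (c ^ j * p ^ (j * (j - 1)))) =
    1 + c - c * p ^ n"
proof (induction n arbitrary: c)
  case 0
  then show ?case by simp
next
  case (Suc n)
  have step: "p ^ j * (1 - c * p ^ Suc j) * (c ^ j * p ^ (j * (j - 1))) +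
      c ^ Suc j * p ^ (Suc j * (Suc j - 1)) =
      (c * p) ^ j * p ^ (j * (j - 1)) + (c - c * p) * ((c * p) ^ j * p ^ (j * j))" for j
  proof (cases j)
    case 0
    then show ?thesis by (simp add: algebra_simps)
  next
    case (Suc j')
    then show ?thesis by (simp add: algebra_simps power_add power_mult_distrib)
  qed
  have "(\<Sum>j\<le>Suc n. qbin p (Suc n) j * (\<Prod>i=Suc j..Suc n. 1 - c * p ^ i) *
        (c ^ j * p ^ (j * (j - 1)))) =
      (\<Sum>j\<le>n. qbin p n j * (\<Prod>i=Suc j..n. 1 - c * p * p ^ i) * ((c * p) ^ j * p ^ (j * (j - 1)))) +
      (c - c * p) *
      (\<Sum>j\<le>n. qbin p n j * (\<Prod>i=Suc j..n. 1 - c * p * p ^ i) * ((c * p) ^ j * p ^ (j * j)))"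
    unfolding qbin_prod_sum_step step
    by (simp add: distrib_left sum.distrib sum_distrib_left mult_ac)
  also have "\<dots> = 1 + c - c * p ^ Suc n"
    unfolding Suc.IH[of "c * p"] qbin_prod_sum_square by (simp add: algebra_simps)
  finally show ?case .
qed

section \<open>Ascending tails\<close>

definition signed :: "nat \<Rightarrow> int set" where
  "signed k = {- int k..int k} - {0}"

text \<open>The letter \<open>w k\<close> is recorded as \<open>sgn (w k)\<close> times the rank of \<open>\<bar>w k\<bar>\<close> among
  \<open>\<bar>w 1\<bar>, \<dots>, \<bar>w k\<bar>\<close>, an element of \<open>signed k\<close>. For consecutive letters so recorded, \<open>asc u v\<close> says
  that there is no descent between them: appending \<open>v\<close> shifts the earlier values of absolute value
  at least \<open>\<bar>v\<bar>\<close> away from 0, so a tie is an ascent precisely when \<open>v\<close> is negative.\<close>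

definition asc :: "int \<Rightarrow> int \<Rightarrow> bool" where
  "asc u v \<longleftrightarrow> u < v \<or> (u = v \<and> v < 0)"

text \<open>The exponent counts the inversions created by the last letter \<open>v\<close>: of
  \<open>- k, ..., k\<close>, there are \<open>k - v\<close> values above \<open>v\<close>, but 0 is
  not a letter, whence the \<open>- 1\<close> for negative \<open>v\<close>.\<close>

definition letter_wt :: "'a::comm_ring_1 \<Rightarrow> 'a \<Rightarrow> nat \<Rightarrow> int \<Rightarrow> 'a" where
  "letter_wt p t k v = (if v > 0 then p ^ nat (int k - v) else t * p ^ nat (int k - v - 1))"

text \<open>The generating function of the words \<open>v\<^sub>m\<^sub>+\<^sub>1, \<dots>, v\<^sub>m\<^sub>+\<^sub>d\<close> without descents that can follow the
  letter \<open>u\<close> at position \<open>m\<close>. For \<open>u = - (m + 1)\<close>, which is not a possible letter, every start is allowed.\<close>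

fun tails :: "'a::comm_ring_1 \<Rightarrow> 'a \<Rightarrow> nat \<Rightarrow> nat \<Rightarrow> int \<Rightarrow> 'a" where
  "tails p t 0 m u = 1"
| "tails p t (Suc d) m u =
    (\<Sum>v | v \<in> signed (Suc m) \<and> asc u v. letter_wt p t (Suc m) v * tails p t d (Suc m) v)"

lemma finite_signed [simp]: "finite (signed k)"
  by (simp add: signed_def)

text \<open>Only positive letters can follow. With \<open>b = k - v\<close> for the letter
  \<open>v\<close> at position \<open>k\<close>, the tails are the partitions with at most
  \<open>d\<close> parts of size at most \<open>m - u\<close>.\<close>

lemma tails_nonneg:
  "u \<le> m \<Longrightarrow> tails p t d m (int u) = qbin p (m - u + d) (m - u)"
proof (induction d arbitrary: m u)
  case 0
  then show ?case by simp
next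
  case (Suc d)
  have "{v. v \<in> signed (Suc m) \<and> asc (int u) v} = (\<lambda>b. int (Suc m - b)) ` {..m - u}"
  proof (intro equalityI subsetI)
    fix v assume "v \<in> {v. v \<in> signed (Suc m) \<and> asc (int u) v}"
    then have "v = int (Suc m - nat (int (Suc m) - v))" "nat (int (Suc m) - v) \<le> m - u"
      using Suc.prems by (auto simp: signed_def asc_def)
    then show "v \<in> (\<lambda>b. int (Suc m - b)) ` {..m - u}" by blast
  qed (use Suc.prems in \<open>auto simp: signed_def asc_def\<close>)
  moreover have "inj_on (\<lambda>b. int (Suc m - b)) {..m - u}"
    by (auto simp: inj_on_def)
  ultimately have "tails p t (Suc d) m (int u) = (\<Sum>b\<le>m - u.
      letter_wt p t (Suc m) (int (Suc m - b)) * tails p t d (Suc m) (int (Suc m - b)))"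
    by (simp add: sum.reindex o_def del: of_nat_diff of_nat_Suc)
  also have "\<dots> = (\<Sum>b\<le>m - u. p ^ b * qbin p (b + d) b)"
  proof (rule sum.cong[OF refl])
    fix b assume b: "b \<in> {..m - u}"
    then have "Suc m - (Suc m - b) = b" "letter_wt p t (Suc m) (int (Suc m - b)) = p ^ b"
      using Suc.prems by (auto simp: letter_wt_def)
    then show "letter_wt p t (Suc m) (int (Suc m - b)) * tails p t d (Suc m) (int (Suc m - b)) =
        p ^ b * qbin p (b + d) b"
      using Suc.IH[of "Suc m - b" "Suc m"] by (simp del: of_nat_diff of_nat_Suc)
  qed
  finally show ?case by (simp add: qbin_hockey_stick)
qed

text \<open>The \<open>r\<close> negative letters come first. Their positions add up to
  \<open>r * Suc m + (r choose 2)\<close>, the weakly decreasing numbers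
  \<open>\<bar>v\<bar> - 1 < s\<close> give \<open>qbin p (r + s - 1) r\<close>, and the positive
  rest gives the last factor. In the induction, passing from \<open>s\<close> to
  \<open>s + 1\<close> admits one new first letter.\<close>

lemma tails_nonpos:
  "s \<le> Suc m \<Longrightarrow> tails p t d m (- int s) =
    (\<Sum>r\<le>d. t ^ r * p ^ (r * Suc m + (r choose 2)) * qbin p (r + s - 1) r * qbin p (m + d) (m + r))"
proof (induction d arbitrary: m s)
  case 0
  then show ?case by simp
next
  case (Suc d)
  let ?f = "\<lambda>s r. t ^ r * p ^ (r * Suc m + (r choose 2)) * qbin p (r + s - 1) r *
    qbin p (m + Suc d) (m + r)"
  from Suc.prems show ?case
  proof (induction s)
    case 0
    have "(\<Sum>r\<le>Suc d. ?f 0 r) = ?f 0 0 + (\<Sum>r\<le>d. ?f 0 (Suc r))"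
      by (rule sum.atMost_Suc_shift)
    then show ?case
      using tails_nonneg[of 0 m p t "Suc d"] by (simp add: qbin_eq_0)
  next
    case (Suc s)
    let ?v = "- int (Suc s)"
    have set: "{v. v \<in> signed (Suc m) \<and> asc ?v v} =
        insert ?v {v. v \<in> signed (Suc m) \<and> asc (- int s) v}"
      using Suc.prems by (auto simp: signed_def asc_def)
    have "?v \<notin> {v. v \<in> signed (Suc m) \<and> asc (- int s) v}"
      by (auto simp: asc_def)
    then have "tails p t (Suc d) m ?v =
        letter_wt p t (Suc m) ?v * tails p t d (Suc m) ?v + tails p t (Suc d) m (- int s)"
      unfolding tails.simps set by (subst sum.insert) auto
    also have "tails p t (Suc d) m (- int s) = ?f (Suc s) 0 + (\<Sum>r\<le>d. ?f s (Suc r))"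
      using Suc by (simp only: sum.atMost_Suc_shift[of "?f s"]) simp
    also have "letter_wt p t (Suc m) ?v * tails p t d (Suc m) ?v =
      (\<Sum>r\<le>d. t ^ Suc r * p ^ (Suc r * Suc m + (Suc r choose 2)) * (p ^ s * qbin p (r + s) r) *
        qbin p (m + Suc d) (m + Suc r))"
    proof -
      have "letter_wt p t (Suc m) ?v = t * p ^ (Suc m + s)"
        by (simp add: letter_wt_def nat_add_distrib)
      moreover have "t * p ^ (Suc m + s) *
          (t ^ r * p ^ (r * Suc (Suc m) + (r choose 2)) * a * b) =
          t ^ Suc r * p ^ (Suc r * Suc m + (Suc r choose 2)) * (p ^ s * a) * b" for r a b
        unfolding choose_two_Suc by (simp add: power_add mult_ac)
      ultimately show ?thesis
        using Suc.prems by (simp only: \<open>\<And>s m. s \<le> Suc m \<Longrightarrow> tails p t d m (- int s) = _\<close> sum_distrib_left) simp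
    qed
    finally have "tails p t (Suc d) m ?v = ?f (Suc s) 0 +
      (\<Sum>r\<le>d. t ^ Suc r * p ^ (Suc r * Suc m + (Suc r choose 2)) * (p ^ s * qbin p (r + s) r) *
        qbin p (m + Suc d) (m + Suc r) + ?f s (Suc r))"
      by (simp add: sum.distrib)
    also have "\<dots> = ?f (Suc s) 0 + (\<Sum>r\<le>d. ?f (Suc s) (Suc r))"
    proof -
      have "qbin p (Suc r + Suc s - 1) (Suc r) =
          p ^ s * qbin p (r + s) r + qbin p (Suc r + s - 1) (Suc r)" for r
        using qbin_Suc_Suc'[of r "r + s" p] by simp
      then show ?thesis by (simp only: distrib_left distrib_right)
    qed
    also have "\<dots> = (\<Sum>r\<le>Suc d. ?f (Suc s) r)"
      by (rule sum.atMost_Suc_shift[symmetric])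
    finally show ?case .
  qed
qed

text \<open>At \<open>s = Suc m\<close> the first letter is unrestricted; the value is
  \<open>F(m + d, m)\<close>. \<open>qbin_trinomial\<close> takes \<open>qbin p (m + d) m\<close>
  out of the sum over \<open>r\<close>, and the q-binomial theorem evaluates the rest.\<close>

lemma tails_all:
  fixes p :: "'a::idom"
  assumes p: "\<And>i. 0 < i \<Longrightarrow> p ^ i \<noteq> 1"
  shows "tails p (- c) d m (- int (Suc m)) =
    qbin p (m + d) m * (\<Prod>i=Suc m..m + d. 1 - c * p ^ i)"
proof -
  have "tails p (- c) d m (- int (Suc m)) =
      (\<Sum>r\<le>d. (- c) ^ r * p ^ (r * Suc m + (r choose 2)) *
        (qbin p (m + r) r * qbin p (m + d) (m + r)))"
    by (subst tails_nonpos) (simp_all add: add.commute mult.assoc)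
  also have "\<dots> = (\<Sum>r\<le>d. qbin p (m + d) m *
      (qbin p d r * p ^ (r choose 2) * (- c * p ^ Suc m) ^ r))"
  proof (rule sum.cong[OF refl])
    fix r assume "r \<in> {..d}"
    moreover have "(- c * p ^ Suc m) ^ r = (- c) ^ r * p ^ (r * Suc m)"
      by (simp only: power_mult_distrib mult.commute[of r] power_mult)
    ultimately show "(- c) ^ r * p ^ (r * Suc m + (r choose 2)) *
        (qbin p (m + r) r * qbin p (m + d) (m + r)) =
      qbin p (m + d) m * (qbin p d r * p ^ (r choose 2) * (- c * p ^ Suc m) ^ r)"
      using qbin_trinomial[OF p, of r d m] by (simp only: power_add) (simp add: mult_ac)
  qed
  also have "\<dots> = qbin p (m + d) m * (\<Prod>i<d. 1 + (- c * p ^ Suc m) * p ^ i)"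
    by (simp only: qbin_theorem flip: sum_distrib_left)
  also have "(\<Prod>i<d. 1 + (- c * p ^ Suc m) * p ^ i) = (\<Prod>i=Suc m..m + d. 1 - c * p ^ i)"
    by (rule prod.reindex_bij_witness[of _ "\<lambda>i. i - Suc m" "\<lambda>i. i + Suc m"])
       (auto simp: power_add mult_ac)
  finally show ?thesis .
qed

section \<open>Peeling off the last letter\<close>

lemma hyperoct_permutes: "w \<in> hyperoct n \<Longrightarrow> w permutes {- int n..int n}"
  by (simp add: hyperoct_def)

lemma hyperoct_minus:
  assumes "w \<in> hyperoct n"
  shows "w (- i) = - w i"
proof (cases "i \<in> {- int n..int n}")
  case True
  then show ?thesis using assms by (simp add: hyperoct_def)
next
  case False
  then have "- i \<notin> {- int n..int n}" by auto
  then show ?thesis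
    using permutes_not_in[OF hyperoct_permutes[OF assms]] False by metis
qed

lemma hyperoctI:
  "w permutes {- int n..int n} \<Longrightarrow> (\<And>i. w (- i) = - w i) \<Longrightarrow> w \<in> hyperoct n"
  by (simp add: hyperoct_def)

lemma hyperoct_0 [simp]: "w \<in> hyperoct n \<Longrightarrow> w 0 = 0"
  using hyperoct_minus[of w n 0] by simp

lemma hyperoct_inj: "w \<in> hyperoct n \<Longrightarrow> w i = w j \<longleftrightarrow> i = j"
  using hyperoct_permutes permutes_inj by (metis injD)

lemma hyperoct_in_range:
  assumes "w \<in> hyperoct n" "\<bar>i\<bar> \<le> int m" "n \<le> m"
  shows "\<bar>w i\<bar> \<le> int m"
proof -
  have "w permutes {- int m..int m}"
    using assms by (intro permutes_subset[OF hyperoct_permutes]) auto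
  then show ?thesis
    using permutes_in_image[of w "{- int m..int m}" i] assms by auto
qed

lemma hyperoct_mono: "m \<le> n \<Longrightarrow> hyperoct m \<subseteq> hyperoct n"
proof
  fix w assume w: "w \<in> hyperoct m" and "m \<le> n"
  then have "w permutes {- int n..int n}"
    by (intro permutes_subset[OF hyperoct_permutes[OF w]]) auto
  then show "w \<in> hyperoct n"
    by (rule hyperoctI) (rule hyperoct_minus[OF w])
qed

lemma hyperoct_comp: "v \<in> hyperoct n \<Longrightarrow> w \<in> hyperoct n \<Longrightarrow> v \<circ> w \<in> hyperoct n"
  by (rule hyperoctI) (simp_all add: permutes_compose hyperoct_permutes hyperoct_minus)

lemma hyperoct_inv:
  assumes "w \<in> hyperoct n"
  shows "inv w \<in> hyperoct n"
proof (rule hyperoctI)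
  show "inv w permutes {- int n..int n}"
    by (rule permutes_inv[OF hyperoct_permutes[OF assms]])
  have bij: "bij w"
    using permutes_bij[OF hyperoct_permutes[OF assms]] .
  show "inv w (- i) = - inv w i" for i
    using hyperoct_minus[OF assms, of "inv w i"] bij
    by (metis bij_inv_eq_iff)
qed

lemma hyperoct_zero: "hyperoct 0 = {id}"
  by (auto simp: hyperoct_def)

text \<open>The element of \<open>hyperoct n\<close> that sends \<open>n\<close> to \<open>v\<close> and is increasing on
  \<open>{- (n - 1)..n - 1}\<close>. It represents the coset of the elements with last letter \<open>v\<close>.\<close>

definition insert_last :: "nat \<Rightarrow> int \<Rightarrow> int \<Rightarrow> int" where
  "insert_last n v m =
     (if \<bar>m\<bar> > int n then m
      else if \<bar>m\<bar> = int n then sgn m * v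
      else if \<bar>m\<bar> \<ge> \<bar>v\<bar> then m + sgn m else m)"

lemma insert_last_minus: "insert_last n v (- m) = - insert_last n v m"
  by (simp add: insert_last_def)

lemma insert_last_strict_mono:
  assumes "v \<in> signed (Suc n)" "- int n \<le> a" "a < b" "b \<le> int n"
  shows "insert_last (Suc n) v a < insert_last (Suc n) v b"
  using assms by (auto simp: insert_last_def signed_def sgn_if)

lemma insert_last_less_iff:
  assumes "v \<in> signed (Suc n)" "\<bar>a\<bar> \<le> int n" "\<bar>b\<bar> \<le> int n"
  shows "insert_last (Suc n) v a < insert_last (Suc n) v b \<longleftrightarrow> a < b"
proof -
  have "strict_mono_on {- int n..int n} (insert_last (Suc n) v)"
    using insert_last_strict_mono[OF assms(1)] by (auto intro!: strict_mono_onI)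
  then show ?thesis
    using assms by (intro strict_mono_on_less) auto
qed

lemma insert_last_less_last_iff:
  assumes "v \<in> signed (Suc n)" "\<bar>u\<bar> \<le> int n"
  shows "v < insert_last (Suc n) v u \<longleftrightarrow> \<not> asc u v"
  using assms by (auto simp: insert_last_def signed_def asc_def sgn_if)

lemma insert_last_in_hyperoct:
  assumes v: "v \<in> signed (Suc n)"
  shows "insert_last (Suc n) v \<in> hyperoct (Suc n)"
proof (rule hyperoctI)
  let ?S = "{- int (Suc n)..int (Suc n)}"
  have cases: "insert_last (Suc n) v a =
      (if a = int (Suc n) then v else if a = - int (Suc n) then - v
       else if a \<ge> \<bar>v\<bar> then a + 1 else if a \<le> - \<bar>v\<bar> then a - 1 else a)"
    if "a \<in> ?S" for a
    using v that by (auto simp: insert_last_def signed_def sgn_if)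
  have inj: "inj_on (insert_last (Suc n) v) ?S"
  proof (rule inj_onI)
    fix a b assume "a \<in> ?S" "b \<in> ?S" "insert_last (Suc n) v a = insert_last (Suc n) v b"
    moreover have "v \<noteq> 0" using v by (simp add: signed_def)
    ultimately show "a = b"
      by (simp only: cases atLeastAtMost_iff split: if_splits)
  qed
  have "insert_last (Suc n) v ` ?S \<subseteq> ?S"
    using v by (auto simp: insert_last_def signed_def sgn_if)
  then have "insert_last (Suc n) v ` ?S = ?S"
    using inj by (rule endo_inj_surj[OF finite_atLeastAtMost_int])
  with inj have "bij_betw (insert_last (Suc n) v) ?S ?S"
    by (rule bij_betw_imageI)
  then show "insert_last (Suc n) v permutes ?S"
    by (rule bij_imp_permutes) (auto simp: insert_last_def)
qed (rule insert_last_minus)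

text \<open>The inverse map reads off the last letter \<open>v\<close> and undoes
  \<open>insert_last (Suc n) v\<close>. What remains fixes \<open>n + 1\<close> and, by oddness,
  \<open>- (n + 1)\<close>, so it lies in \<open>hyperoct n\<close>.\<close>

lemma bij_betw_insert_last:
  "bij_betw (\<lambda>(w, v). insert_last (Suc n) v \<circ> w) (hyperoct n \<times> signed (Suc n)) (hyperoct (Suc n))"
proof (rule bij_betw_byWitness
    [where f' = "\<lambda>w. (inv (insert_last (Suc n) (w (int (Suc n)))) \<circ> w, w (int (Suc n)))"])
  let ?c = "insert_last (Suc n)"
  have last: "(?c v \<circ> w) (int (Suc n)) = v" if "w \<in> hyperoct n" for w v
    using permutes_not_in[OF hyperoct_permutes[OF that], of "int (Suc n)"]
    by (simp add: insert_last_def)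
  have bij: "bij (?c v)" if "v \<in> signed (Suc n)" for v
    using hyperoct_permutes[OF insert_last_in_hyperoct[OF that]] by (rule permutes_bij)
  show "\<forall>a\<in>hyperoct n \<times> signed (Suc n).
      (inv (?c ((case a of (w, v) \<Rightarrow> ?c v \<circ> w) (int (Suc n)))) \<circ> (case a of (w, v) \<Rightarrow> ?c v \<circ> w),
       (case a of (w, v) \<Rightarrow> ?c v \<circ> w) (int (Suc n))) = a"
    using bij last by (auto simp: fun_eq_iff bij_is_inj simp del: of_nat_Suc)
  have signed: "w (int (Suc n)) \<in> signed (Suc n)" if "w \<in> hyperoct (Suc n)" for w
    using hyperoct_in_range[OF that, of "int (Suc n)" "Suc n"]
      hyperoct_inj[OF that, of "int (Suc n)" 0] hyperoct_0[OF that]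
    by (auto simp: signed_def)
  show "\<forall>w\<in>hyperoct (Suc n). (case (inv (?c (w (int (Suc n)))) \<circ> w, w (int (Suc n))) of
      (w, v) \<Rightarrow> ?c v \<circ> w) = w"
    using bij signed by (auto simp: fun_eq_iff bij_is_surj surj_f_inv_f simp del: of_nat_Suc)
  show "(\<lambda>(w, v). ?c v \<circ> w) ` (hyperoct n \<times> signed (Suc n)) \<subseteq> hyperoct (Suc n)"
    using hyperoct_mono[of n "Suc n"] insert_last_in_hyperoct hyperoct_comp by auto
  show "(\<lambda>w. (inv (?c (w (int (Suc n)))) \<circ> w, w (int (Suc n)))) ` hyperoct (Suc n)
      \<subseteq> hyperoct n \<times> signed (Suc n)"
  proof (rule image_subsetI)
    fix w assume w: "w \<in> hyperoct (Suc n)"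
    let ?v = "w (int (Suc n))" and ?w' = "inv (?c (w (int (Suc n)))) \<circ> w"
    have w': "?w' \<in> hyperoct (Suc n)"
      using w signed[OF w] by (intro hyperoct_comp hyperoct_inv insert_last_in_hyperoct)
    have "?c ?v (int (Suc n)) = ?v"
      by (simp add: insert_last_def)
    then have last_fixed: "?w' (int (Suc n)) = int (Suc n)"
      using bij[OF signed[OF w]] by (metis bij_inv_eq_iff comp_apply)
    have "?w' permutes {- int n..int n}"
    proof (rule permutes_superset[OF hyperoct_permutes[OF w']])
      fix i assume "i \<in> {- int (Suc n)..int (Suc n)} - {- int n..int n}"
      then have "i = int (Suc n) \<or> i = - int (Suc n)" by auto
      then show "?w' i = i"
        using last_fixed hyperoct_minus[OF w', of "int (Suc n)"] by (auto simp del: of_nat_Suc)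
    qed
    then have "?w' \<in> hyperoct n"
      using hyperoct_minus[OF w'] unfolding hyperoct_def by blast
    then show "(?w', ?v) \<in> hyperoct n \<times> signed (Suc n)"
      using signed[OF w] by simp
  qed
qed

text \<open>Negative positions are included: besides the ordinary inversions this counts the
  \<open>i\<close> in \<open>{1..k}\<close> with \<open>w i + w k < 0\<close>. The sum over
  \<open>k\<close> is thus the usual length formula of type B.\<close>

definition invs_at :: "(int \<Rightarrow> int) \<Rightarrow> nat \<Rightarrow> nat" where
  "invs_at w k = card {i \<in> {- int k..<int k} - {0}. w i > w (int k)}"

definition invs :: "nat \<Rightarrow> (int \<Rightarrow> int) \<Rightarrow> nat" where
  "invs n w = (\<Sum>k=1..n. invs_at w k)"

text \<open>At the last position the window is all of \<open>{- n..n}\<close>, which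
  \<open>w\<close> permutes, so it suffices to count the values above \<open>w n\<close>, leaving
  out \<open>w 0 = 0\<close>.\<close>

lemma invs_at_last:
  assumes w: "w \<in> hyperoct n" and n: "0 < n"
  shows "invs_at w n = nat (int n - w (int n) - (if w (int n) < 0 then 1 else 0))"
proof -
  let ?S = "{- int n..int n}" and ?v = "w (int n)"
  have v: "\<bar>?v\<bar> \<le> int n"
    using hyperoct_in_range[OF w, of "int n" n] by simp
  have "card {i \<in> ?S. ?v < w i} = card {?v<..int n}"
  proof (rule bij_betw_same_card[of w])
    have "w ` {i \<in> ?S. ?v < w i} = {u \<in> w ` ?S. ?v < u}"
      by auto
    also have "\<dots> = {u \<in> ?S. ?v < u}"
      by (simp only: permutes_image[OF hyperoct_permutes[OF w]])
    also have "\<dots> = {?v<..int n}" using v by auto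
    finally show "bij_betw w {i \<in> ?S. ?v < w i} {?v<..int n}"
      using hyperoct_inj[OF w] by (auto simp: bij_betw_def inj_on_def)
  qed
  moreover have "{i \<in> {- int n..<int n} - {0}. ?v < w i} = {i \<in> ?S. ?v < w i} - {0}"
    by (auto simp: order.order_iff_strict)
  moreover have "0 \<in> {i \<in> ?S. ?v < w i} \<longleftrightarrow> ?v < 0"
    using hyperoct_0[OF w] by simp
  ultimately show ?thesis
    unfolding invs_at_def by (simp add: card_Diff_singleton_if nat_diff_distrib')
qed

section \<open>Change of the statistics under a new last letter\<close>

context
  fixes n :: nat and v :: int and w w' :: "int \<Rightarrow> int"
  assumes v: "v \<in> signed (Suc n)" and w': "w' \<in> hyperoct n"
  defines "w \<equiv> insert_last (Suc n) v \<circ> w'"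
begin

lemma insert_last_comp_in_hyperoct: "w \<in> hyperoct (Suc n)"
  unfolding w_def
  using w' hyperoct_mono[of n "Suc n"] insert_last_in_hyperoct[OF v] by (auto intro: hyperoct_comp)

lemma insert_last_comp_last: "w (int (Suc n)) = v"
  unfolding w_def using permutes_not_in[OF hyperoct_permutes[OF w'], of "int (Suc n)"]
  by (simp add: insert_last_def)

text \<open>\<open>insert_last (Suc n) v\<close> is increasing on \<open>{- n..n}\<close>, so signs,
  inversions and descents among the first \<open>n\<close> positions are inherited from
  \<open>w'\<close>.\<close>

lemma insert_last_comp_less_iff:
  "\<bar>i\<bar> \<le> int n \<Longrightarrow> \<bar>j\<bar> \<le> int n \<Longrightarrow> w i < w j \<longleftrightarrow> w' i < w' j"
  unfolding w_def comp_def using hyperoct_in_range[OF w', of _ n]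
  by (intro insert_last_less_iff[OF v]) auto

lemma neg_insert_last: "neg (Suc n) w = neg n w' + (if v < 0 then 1 else 0)"
proof -
  have "w (int i) < 0 \<longleftrightarrow> w' (int i) < 0" if "i \<le> n" for i
    using insert_last_comp_less_iff[of "int i" 0] hyperoct_0[OF w']
      hyperoct_0[OF insert_last_comp_in_hyperoct] that by simp
  then have "{i \<in> {1..Suc n}. w (int i) < 0} =
      {i \<in> {1..n}. w' (int i) < 0} \<union> (if v < 0 then {Suc n} else {})"
    using insert_last_comp_last by (auto simp: le_Suc_eq simp del: of_nat_Suc)
  then show ?thesis
    unfolding neg_def by (auto simp: card_insert_if)
qed

lemma invs_insert_last:
  "invs (Suc n) w = invs n w' + nat (int (Suc n) - v - (if v < 0 then 1 else 0))"
proof -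
  have "invs_at w k = invs_at w' k" if "k \<in> {1..n}" for k
    unfolding invs_at_def
    by (rule arg_cong[of _ _ card]) (use that in \<open>auto simp: insert_last_comp_less_iff\<close>)
  then have "(\<Sum>k=1..n. invs_at w k) = (\<Sum>k=1..n. invs_at w' k)"
    by (rule sum.cong[OF refl])
  then show ?thesis
    using invs_at_last[OF insert_last_comp_in_hyperoct]
    by (simp add: invs_def insert_last_comp_last del: of_nat_Suc)
qed

lemma Des_insert_last:
  "Des (Suc n) w = Des n w' \<union> (if asc (w' (int n)) v then {} else {n})"
proof -
  have "w (int i + 1) < w (int i) \<longleftrightarrow> w' (int i + 1) < w' (int i)" if "i < n" for i
    using that by (intro insert_last_comp_less_iff) auto
  moreover have "w (int n + 1) < w (int n) \<longleftrightarrow> \<not> asc (w' (int n)) v"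
    using insert_last_comp_last insert_last_less_last_iff[OF v hyperoct_in_range[OF w', of "int n" n]]
    unfolding w_def by (simp add: add.commute)
  ultimately show ?thesis
    by (auto simp: Des_def less_Suc_eq)
qed

end

text \<open>The function \<open>\<phi>\<close> of the last letter is kept because that letter
  decides whether the next one makes a descent.\<close>

definition gf :: "'a::comm_ring_1 \<Rightarrow> 'a \<Rightarrow> (nat \<Rightarrow> 'a) \<Rightarrow> nat \<Rightarrow> (int \<Rightarrow> 'a) \<Rightarrow> 'a" where
  "gf p t x n \<phi> =
     (\<Sum>w\<in>hyperoct n. t ^ neg n w * p ^ invs n w * (\<Prod>i\<in>Des n w. x i) * \<phi> (w (int n)))"

lemma gf_zero: "gf p t x 0 \<phi> = \<phi> 0"
  by (simp add: gf_def hyperoct_zero neg_def invs_def Des_def)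

lemma gf_add: "gf p t x n (\<lambda>u. \<phi> u + \<psi> u) = gf p t x n \<phi> + gf p t x n \<psi>"
  by (simp add: gf_def distrib_left sum.distrib)

lemma gf_mult: "gf p t x n (\<lambda>u. a * \<phi> u) = a * gf p t x n \<phi>"
  by (simp add: gf_def sum_distrib_left mult_ac)

lemma gf_Suc:
  "gf p t x (Suc n) \<phi> =
    gf p t x n (\<lambda>u. \<Sum>v\<in>signed (Suc n). (if asc u v then 1 else x n) * (letter_wt p t (Suc n) v * \<phi> v))"
proof -
  let ?wt = "\<lambda>n w. t ^ neg n w * p ^ invs n w * (\<Prod>i\<in>Des n w. x i)"
  have "?wt (Suc n) (insert_last (Suc n) v \<circ> w) * \<phi> ((insert_last (Suc n) v \<circ> w) (int (Suc n))) =
      ?wt n w * ((if asc (w (int n)) v then 1 else x n) * (letter_wt p t (Suc n) v * \<phi> v))"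
    if "w \<in> hyperoct n" "v \<in> signed (Suc n)" for w v
  proof -
    have "finite (Des n w)" "n \<notin> Des n w"
      by (auto simp: Des_def)
    then have "(\<Prod>i\<in>Des (Suc n) (insert_last (Suc n) v \<circ> w). x i) =
        (\<Prod>i\<in>Des n w. x i) * (if asc (w (int n)) v then 1 else x n)"
      using that by (simp add: Des_insert_last)
    moreover have "v \<noteq> 0"
      using that by (simp add: signed_def)
    ultimately show ?thesis
      unfolding insert_last_comp_last[OF that(2,1)] neg_insert_last[OF that(2,1)]
        invs_insert_last[OF that(2,1)]
      by (cases "v < 0") (simp_all add: letter_wt_def power_add mult_ac del: of_nat_Suc)
  qed
  then have "gf p t x (Suc n) \<phi> = (\<Sum>(w, v)\<in>hyperoct n \<times> signed (Suc n). ?wt n w *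
      ((if asc (w (int n)) v then 1 else x n) * (letter_wt p t (Suc n) v * \<phi> v)))"
    unfolding gf_def sum.reindex_bij_betw[OF bij_betw_insert_last, symmetric]
    by (intro sum.cong refl) (simp only: case_prod_unfold mem_Times_iff)
  then show ?thesis
    by (simp only: gf_def sum_distrib_left sum.cartesian_product)
qed

text \<open>The recursion for \<open>S_m\<close>, which is \<open>gf\<close> at \<open>m\<close> of
  \<open>tails p t (n - m) m\<close>. The weight of position \<open>m\<close> is
  \<open>1 - x m\<close> on ascents plus \<open>x m\<close> everywhere; in the second part the tail
  no longer depends on the last letter.\<close>

lemma gf_tails:
  "gf p t x (Suc m) (tails p t d (Suc m)) =
    (1 - x m) * gf p t x m (tails p t (Suc d) m) +
    x m * tails p t (Suc d) m (- int (Suc m)) * gf p t x m (\<lambda>_. 1)"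
proof -
  let ?g = "\<lambda>v. letter_wt p t (Suc m) v * tails p t d (Suc m) v"
  have all: "{v. v \<in> signed (Suc m) \<and> asc (- int (Suc m)) v} = signed (Suc m)"
    by (auto simp: signed_def asc_def)
  have "(\<Sum>v\<in>signed (Suc m). (if asc u v then 1 else x m) * ?g v) =
      (1 - x m) * tails p t (Suc d) m u + x m * tails p t (Suc d) m (- int (Suc m)) * 1" for u
  proof -
    have "(\<Sum>v\<in>signed (Suc m). (if asc u v then 1 else x m) * ?g v) =
        (\<Sum>v\<in>signed (Suc m). (1 - x m) * (if asc u v then ?g v else 0) + x m * ?g v)"
      by (rule sum.cong) (auto simp: algebra_simps)
    also have "\<dots> = (1 - x m) * (\<Sum>v\<in>signed (Suc m). if asc u v then ?g v else 0) +
        x m * (\<Sum>v\<in>signed (Suc m). ?g v)"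
      by (simp only: sum.distrib sum_distrib_left)
    finally show ?thesis
      by (simp only: tails.simps all mult_1_right sum.inter_filter[OF finite_signed, symmetric])
  qed
  then show ?thesis
    unfolding gf_Suc by (simp only: gf_add gf_mult)
qed

text \<open>Strong induction, since the recursion involves all \<open>G_m\<close> with
  \<open>m < n\<close>. Everything is multiplied by \<open>(1 - x 0) * (1 - x 1)\<close>, which
  makes the claim for \<open>m\<close> applicable without division.\<close>

lemma gf_product:
  fixes p c y :: "'a::idom"
  assumes p: "\<And>i. 0 < i \<Longrightarrow> p ^ i \<noteq> 1"
  defines "x \<equiv> \<lambda>i. y * c ^ i * p ^ (i * (i - 1))"
  shows "(1 - x 0) * (1 - x 1) * gf p (- c) x n (\<lambda>_. 1) = (1 - y * c * p ^ n) * (\<Prod>i\<le>n. 1 - x i)"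
proof (induction n rule: less_induct)
  case (less n)
  let ?b = "\<lambda>j. qbin p n j * (\<Prod>i=Suc j..n. 1 - c * p ^ i)"
  have all: "tails p (- c) d m (- int (Suc m)) =
      qbin p (m + d) m * (\<Prod>i=Suc m..m + d. 1 - c * p ^ i)" for d m
    by (rule tails_all) (rule p)
  let ?s = "\<lambda>j. ?b j * (x j * (1 - y * c * p ^ j))"
  \<comment> \<open>The solved recursion: each step multiplies by \<open>1 - x m\<close> and adds
    the summand \<open>?s m\<close>.\<close>
  have partial: "m \<le> n \<Longrightarrow> (1 - x 0) * (1 - x 1) * gf p (- c) x m (tails p (- c) (n - m) m) =
      (\<Prod>i<m. 1 - x i) * ((1 - x 0) * (1 - x 1) + (\<Sum>j<m. ?s j))" for m
  proof (induction m)
    case 0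
    then show ?case
      using tails_nonneg[of 0 0 p "- c" n] by (simp add: gf_zero)
  next
    case (Suc m)
    have d: "n - m = Suc (n - Suc m)" "m + Suc (n - Suc m) = n"
      using Suc.prems by simp_all
    have "(1 - x 0) * (1 - x 1) * gf p (- c) x (Suc m) (tails p (- c) (n - Suc m) (Suc m)) =
        (1 - x m) * ((1 - x 0) * (1 - x 1) * gf p (- c) x m (tails p (- c) (n - m) m)) +
        x m * ?b m * ((1 - x 0) * (1 - x 1) * gf p (- c) x m (\<lambda>_. 1))"
      unfolding gf_tails all d by (simp only: distrib_left mult_ac)
    also have "(1 - x 0) * (1 - x 1) * gf p (- c) x m (\<lambda>_. 1) =
        (1 - y * c * p ^ m) * ((\<Prod>i<m. 1 - x i) * (1 - x m))"
      using less.IH[of m] Suc.prems by (simp flip: lessThan_Suc_atMost)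
    also have "(1 - x 0) * (1 - x 1) * gf p (- c) x m (tails p (- c) (n - m) m) =
        (\<Prod>i<m. 1 - x i) * ((1 - x 0) * (1 - x 1) + (\<Sum>j<m. ?s j))"
      using Suc by simp
    finally show ?case
      by (simp add: algebra_simps)
  qed
  \<comment> \<open>As \<open>j * (j - 1) + j = j * j\<close>, the sum splits into the two
    q-binomial sums evaluated above.\<close>
  have "x j * (1 - y * c * p ^ j) =
      y * (c ^ j * p ^ (j * (j - 1))) - y\<^sup>2 * c * (c ^ j * p ^ (j * j))" for j
    by (cases j) (simp_all add: x_def algebra_simps power_add power2_eq_square)
  then have "(\<Sum>j\<le>n. ?s j) = y * (\<Sum>j\<le>n. ?b j * (c ^ j * p ^ (j * (j - 1)))) -
      y\<^sup>2 * c * (\<Sum>j\<le>n. ?b j * (c ^ j * p ^ (j * j)))"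
    by (simp add: sum_subtractf right_diff_distrib sum_distrib_left mult_ac)
  also have "\<dots> = y * (1 + c - c * p ^ n) - y\<^sup>2 * c"
    unfolding qbin_prod_sum_pronic qbin_prod_sum_square by simp
  finally have "(1 - x 0) * (1 - x 1) + (\<Sum>j\<le>n. ?s j) = 1 - y * c * p ^ n"
    by (simp add: x_def algebra_simps power2_eq_square)
  \<comment> \<open>The summand at \<open>j = n\<close> is \<open>x n * (1 - y * c * p ^ n)\<close>,
    because \<open>F(n, n) = 1\<close>.\<close>
  then have "(1 - x 0) * (1 - x 1) + (\<Sum>j<n. ?s j) = (1 - x n) * (1 - y * c * p ^ n)"
    by (simp add: algebra_simps flip: lessThan_Suc_atMost)
  moreover have "tails p (- c) (n - n) n = (\<lambda>_. 1)"
    by (simp add: fun_eq_iff)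
  ultimately show ?case
    using partial[of n] by (simp add: mult_ac flip: lessThan_Suc_atMost)
qed

section \<open>Length and inversions\<close>

lemma cox_gen_involution: "cox_gen i \<circ> cox_gen i = id"
  by (auto simp: cox_gen_def transpose_def fun_eq_iff)

lemma cox_gen_minus: "cox_gen i (- m) = - cox_gen i m"
  by (auto simp: cox_gen_def transpose_def)

lemma cox_gen_in_hyperoct:
  assumes "i < n"
  shows "cox_gen i \<in> hyperoct n"
proof (rule hyperoctI)
  show "cox_gen i permutes {- int n..int n}"
    using assms by (auto simp: cox_gen_def intro!: permutes_compose permutes_swap_id)
qed (rule cox_gen_minus)

text \<open>Up to sign, \<open>(gen_low i, int i + 1)\<close> is the only pair of nonzero integers whose order is
  reversed by \<open>cox_gen i\<close>.\<close>

definition gen_low :: "nat \<Rightarrow> int" where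
  "gen_low i = (if i = 0 then - 1 else int i)"

lemma cox_gen_reverses:
  assumes "a \<noteq> 0" "b \<noteq> 0" "a < b" "cox_gen i b < cox_gen i a"
  shows "(a = gen_low i \<and> b = int i + 1) \<or> (a = - (int i + 1) \<and> b = - gen_low i)"
  using assms by (auto simp: cox_gen_def gen_low_def transpose_def split: if_splits)

lemma cox_gen_swap:
  "cox_gen i (gen_low i) = int i + 1" "cox_gen i (int i + 1) = gen_low i"
  "cox_gen i (- int i - 1) = - gen_low i"
  by (auto simp: cox_gen_def gen_low_def transpose_def)

definition Inv :: "nat \<Rightarrow> (int \<Rightarrow> int) \<Rightarrow> (nat \<times> int) set" where
  "Inv n w = (SIGMA k:{1..n}. {a \<in> {- int k..<int k} - {0}. w a > w (int k)})"

lemma finite_larger_letters: "finite {a \<in> {- int k..<int k} - {0}. w a > w (int k)}"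
  by (rule finite_subset[of _ "{- int k..<int k}"]) auto

lemma card_Inv: "card (Inv n w) = invs n w"
  unfolding Inv_def invs_def invs_at_def 
  by (rule card_SigmaI) (intro ballI finite_atLeastAtMost finite_larger_letters)+

lemma finite_Inv: "finite (Inv n w)"
  unfolding Inv_def by (intro finite_SigmaI finite_atLeastAtMost finite_larger_letters)

lemma Inv_cox_gen_comp:
  assumes w: "w \<in> hyperoct n" and new: "(k, a) \<in> Inv n (cox_gen i \<circ> w)" "(k, a) \<notin> Inv n w"
  shows "(a = inv w (gen_low i) \<and> int k = inv w (int i + 1)) \<or>
    (a = - inv w (int i + 1) \<and> int k = - inv w (gen_low i))"
proof -
  have k: "k \<in> {1..n}" "a \<in> {- int k..<int k} - {0}" "cox_gen i (w (int k)) < cox_gen i (w a)"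
    using new(1) by (auto simp: Inv_def)
  have "w a \<noteq> w (int k)" "w a \<noteq> 0" "w (int k) \<noteq> 0"
    using k hyperoct_inj[OF w, of a "int k"] hyperoct_inj[OF w, of a 0]
      hyperoct_inj[OF w, of "int k" 0] hyperoct_0[OF w] by auto
  moreover have "\<not> w (int k) < w a"
    using new(2) k by (auto simp: Inv_def)
  ultimately have "(w a = gen_low i \<and> w (int k) = int i + 1) \<or>
      (w a = - (int i + 1) \<and> w (int k) = - gen_low i)"
    using k(3) by (intro cox_gen_reverses) auto
  moreover have "inv w (w b) = b" for b
    using permutes_inj[OF hyperoct_permutes[OF w]] by (rule inv_f_f)
  ultimately show ?thesis
    using hyperoct_minus[OF hyperoct_inv[OF w]] by metis
qed

text \<open>By \<open>Inv_cox_gen_comp\<close> a new inversion is one of two pairs exchanged by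
  sending \<open>(k, a)\<close> to \<open>(- a, - k)\<close>. As
  \<open>\<bar>a\<bar> \<le> k\<close>, only one of them qualifies unless they coincide; it is
  \<open>?q\<close>.\<close>

lemma invs_cox_gen_comp_le:
  assumes "w \<in> hyperoct n"
  shows "invs n (cox_gen i \<circ> w) \<le> Suc (invs n w)"
proof -
  let ?x = "inv w (gen_low i)" and ?y = "inv w (int i + 1)"
  let ?q = "if \<bar>?x\<bar> \<le> ?y then (nat ?y, ?x) else (nat (- ?x), - ?y)"
  have "Inv n (cox_gen i \<circ> w) \<subseteq> insert ?q (Inv n w)"
  proof (clarify, rule ccontr)
    fix k a assume new: "(k, a) \<in> Inv n (cox_gen i \<circ> w)" "(k, a) \<noteq> ?q" "(k, a) \<notin> Inv n w"
    have "\<bar>a\<bar> \<le> int k"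
      using new(1) by (auto simp: Inv_def)
    then show False
      using Inv_cox_gen_comp[OF assms new(1,3)] new(2) by (auto split: if_splits)
  qed
  then have "card (Inv n (cox_gen i \<circ> w)) \<le> card (insert ?q (Inv n w))"
    by (intro card_mono) (auto simp: finite_Inv)
  also have "\<dots> \<le> Suc (card (Inv n w))"
    by (simp add: card_insert_if finite_Inv)
  finally show ?thesis by (simp add: card_Inv)
qed

text \<open>A new inversion would need \<open>inv w (gen_low i) < inv w (int i + 1)\<close>, so none
  arises, while the inversion \<open>?q\<close> formed by the exchanged values is lost.\<close>

lemma invs_cox_gen_comp_less:
  assumes w: "w \<in> hyperoct n" and i: "i < n"
    and less: "inv w (int i + 1) < inv w (gen_low i)"
  shows "invs n (cox_gen i \<circ> w) < invs n w"
proof -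
  let ?x = "inv w (gen_low i)" and ?y = "inv w (int i + 1)"
  let ?q = "if \<bar>?y\<bar> \<le> ?x then (nat ?x, ?y) else (nat (- ?y), - ?x)"
  have iw: "inv w \<in> hyperoct n" by (rule hyperoct_inv[OF w])
  have wx: "w ?x = gen_low i" and wy: "w ?y = int i + 1"
    using permutes_surj[OF hyperoct_permutes[OF w]] by (simp_all add: surj_f_inv_f)
  have range: "\<bar>?x\<bar> \<le> int n" "\<bar>?y\<bar> \<le> int n"
    using i by (auto intro!: hyperoct_in_range[OF iw] simp: gen_low_def)
  have nz: "?x \<noteq> 0" "?y \<noteq> 0"
    using wx wy hyperoct_0[OF w] by (auto simp: gen_low_def split: if_splits)
  have low: "gen_low i < int i + 1" by (simp add: gen_low_def)
  have "Inv n (cox_gen i \<circ> w) \<subseteq> Inv n w"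
  proof (clarify, rule ccontr)
    fix k a assume new: "(k, a) \<in> Inv n (cox_gen i \<circ> w)" "(k, a) \<notin> Inv n w"
    then show False
      using Inv_cox_gen_comp[OF w new] less by (auto simp: Inv_def)
  qed
  moreover have "?q \<in> Inv n w"
    using less range nz wx wy low hyperoct_minus[OF w] by (auto simp: Inv_def)
  moreover have "?q \<notin> Inv n (cox_gen i \<circ> w)"
    using less wx wy low hyperoct_minus[OF w] by (auto simp: Inv_def cox_gen_swap cox_gen_minus)
  ultimately have "Inv n (cox_gen i \<circ> w) \<subset> Inv n w" by blast
  then show ?thesis
    unfolding card_Inv[symmetric] by (rule psubset_card_mono[OF finite_Inv])
qed

text \<open>An increasing integer sequence from \<open>w 0 = 0\<close> satisfies
  \<open>w k \<ge> k\<close>; descending from \<open>w n \<le> n\<close> gives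
  \<open>w k \<le> k\<close>.\<close>

lemma hyperoct_no_descents:
  assumes w: "w \<in> hyperoct n" and incr: "\<And>i. i < n \<Longrightarrow> w (int i) < w (int i + 1)"
  shows "w = id"
proof -
  have low: "int k \<le> w (int k)" if "k \<le> n" for k
    using that
  proof (induction k)
    case 0
    then show ?case using hyperoct_0[OF w] by simp
  next
    case (Suc k)
    then show ?case using incr[of k] by (simp add: add.commute)
  qed
  have "w (int k) \<le> int k" if "k \<le> n" for k
    using that
  proof (induction k rule: inc_induct)
    case base
    then show ?case using hyperoct_in_range[OF w, of "int n" n] by simp
  next
    case (step k)
    then show ?case using incr[of k] by (simp add: add.commute)
  qed
  then have pos: "w (int k) = int k" if "k \<le> n" for k
    using low that by (simp add: order_antisym)
  have "w i = i" for i
  proof (cases "\<bar>i\<bar> \<le> int n")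
    case True
    then show ?thesis
      using pos[of "nat i"] pos[of "nat (- i)"] hyperoct_minus[OF w, of "- i"]
      by (cases "0 \<le> i") auto
  next
    case False
    then show ?thesis
      by (intro permutes_not_in[OF hyperoct_permutes[OF w]]) auto
  qed
  then show ?thesis by auto
qed

lemma invs_id: "invs n id = 0"
  by (auto simp: invs_def invs_at_def card_eq_0_iff)

lemma word_prod_Cons: "word_prod (i # is) = cox_gen i \<circ> word_prod is"
  by (simp add: word_prod_def)

lemma word_prod_invs:
  "set is \<subseteq> {..<n} \<Longrightarrow> word_prod is \<in> hyperoct n \<and> invs n (word_prod is) \<le> length is"
proof (induction "is")
  case Nil
  have "id \<in> hyperoct n" by (auto intro!: hyperoctI permutes_id)
  then show ?case by (simp add: word_prod_def invs_id flip: id_def)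
next
  case (Cons i "is")
  then have IH: "word_prod is \<in> hyperoct n" "invs n (word_prod is) \<le> length is" and i: "i < n"
    by auto
  have "cox_gen i \<circ> word_prod is \<in> hyperoct n"
    by (rule hyperoct_comp[OF cox_gen_in_hyperoct[OF i] IH(1)])
  moreover have "invs n (cox_gen i \<circ> word_prod is) \<le> length (i # is)"
    using invs_cox_gen_comp_le[OF IH(1), of i] IH(2) by simp
  ultimately show ?case
    unfolding word_prod_Cons by (rule conjI)
qed

lemma hyperoct_word:
  "w \<in> hyperoct n \<Longrightarrow> \<exists>is. length is = invs n w \<and> set is \<subseteq> {..<n} \<and> word_prod is = w"
proof (induction "invs n w" arbitrary: w rule: less_induct)
  case less
  show ?case
  proof (cases "w = id")
    case True
    then show ?thesis by (intro exI[of _ "[]"]) (simp add: word_prod_def invs_id)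
  next
    case False
    have iw: "inv w \<in> hyperoct n" by (rule hyperoct_inv[OF less.prems])
    have "inv w \<noteq> id"
      using False permutes_inv_inv[OF hyperoct_permutes[OF less.prems]] by (metis inv_id)
    \<comment> \<open>Generators on the left exchange values, so the descent is sought in
      \<open>inv w\<close>.\<close>
    then obtain i where i: "i < n" "\<not> inv w (int i) < inv w (int i + 1)"
      using hyperoct_no_descents[OF iw] by blast
    then have "inv w (int i + 1) < inv w (int i)"
      using hyperoct_inj[OF iw, of "int i" "int i + 1"] by simp
    \<comment> \<open>For \<open>i = 0\<close>, \<open>inv w 1 < 0\<close> gives
      \<open>inv w 1 < inv w (- 1)\<close> by oddness.\<close>
    then have "inv w (int i + 1) < inv w (gen_low i)"
      using hyperoct_minus[OF iw, of 1] hyperoct_0[OF iw] by (auto simp: gen_low_def)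
    then have inv_less: "invs n (cox_gen i \<circ> w) < invs n w"
      by (rule invs_cox_gen_comp_less[OF less.prems i(1)])
    moreover have "cox_gen i \<circ> w \<in> hyperoct n"
      by (rule hyperoct_comp[OF cox_gen_in_hyperoct[OF i(1)] less.prems])
    ultimately obtain "is" where is_word: "length is = invs n (cox_gen i \<circ> w)" "set is \<subseteq> {..<n}"
        "word_prod is = cox_gen i \<circ> w"
      using less.hyps by blast
    have "word_prod (i # is) = w"
      unfolding word_prod_Cons is_word(3) by (simp add: cox_gen_involution flip: comp_assoc)
    moreover have "set (i # is) \<subseteq> {..<n}"
      using i is_word by simp
    \<comment> \<open>The lost inversion yields \<open>length (i # is) \<le> invs n w\<close>; with
      this converse the length is exact.\<close>
    moreover from this have "invs n w \<le> length (i # is)"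
      using word_prod_invs[of "i # is" n] calculation by simp
    ultimately show ?thesis
      using inv_less is_word(1) by (intro exI[of _ "i # is"]) simp
  qed
qed

lemma cox_length_eq_invs:
  assumes "w \<in> hyperoct n"
  shows "cox_length n w = invs n w"
  unfolding cox_length_def
  by (rule Least_equality) (use hyperoct_word[OF assms] word_prod_invs in auto)

section \<open>The exponent\<close>

text \<open>The contribution of a descent at \<open>i\<close> to \<open>X_exponent\<close>; for
  \<open>\<delta> \<in> {0, 1}\<close> it is the exponent in the factor of index \<open>i\<close> of
  the product.\<close>

definition desc_wt :: "nat \<Rightarrow> nat \<Rightarrow> nat \<Rightarrow> int" where
  "desc_wt n \<delta> i = 2 * ((int n)\<^sup>2 - (int i)\<^sup>2) + (2 * int \<delta> - 3) * (int n - int i) + 2 * int n + int \<delta>"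

lemma X_exponent_eq:
  assumes "w \<in> hyperoct n"
  shows "X_exponent n \<delta> w =
    (\<Sum>i\<in>Des n w. desc_wt n \<delta> i) - 2 * int (invs n w) - (2 * int \<delta> - 1) * int (neg n w)"
proof -
  have "(\<Sum>i\<in>Des n w. desc_wt n \<delta> i) =
      2 * sigma n w + (2 * int \<delta> - 3) * rmaj n w + (2 * int n + int \<delta>) * int (des n w)"
    by (simp only: desc_wt_def sigma_def rmaj_def des_def sum.distrib sum_distrib_left sum_constant
        add.assoc distrib_right mult.commute[of _ "int (card _)"] distrib_left)
  then show ?thesis
    by (simp add: X_exponent_def cox_length_eq_invs[OF assms] algebra_simps)
qed

section \<open>Nonnegativity of the exponent\<close>

lemma increasing_run:
  fixes w :: "int \<Rightarrow> int"
  assumes "\<And>i. a \<le> i \<Longrightarrow> i < k \<Longrightarrow> w (int i) < w (int i + 1)" "a < k"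
  shows "w (int a) < w (int k)"
  using assms
proof (induction k)
  case (Suc k)
  have "w (int k) < w (int (Suc k))"
    using Suc.prems(1)[of k] Suc.prems(2) by (simp add: add.commute)
  moreover have "a = k \<or> w (int a) < w (int k)"
    using Suc by (simp add: less_Suc_eq) blast
  ultimately show ?case by auto
qed simp

text \<open>If \<open>e\<close> is the last descent before \<open>k\<close>, then every \<open>a < k\<close> with \<open>w a > w k\<close> satisfies \<open>a \<le> e\<close>.\<close>

lemma letter_exponent_le:
  assumes w: "w \<in> hyperoct n" and k: "k \<in> {1..n}"
  shows "2 * int (invs_at w k) + (2 * int \<delta> - 1) * (if w (int k) < 0 then 1 else 0) \<le>
    (\<Sum>e | e \<in> Des n w \<and> e < k. 2 * (int k + int e) + 2 * int \<delta> - 1)"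
proof -
  let ?D = "{e. e \<in> Des n w \<and> e < k}" and ?f = "\<lambda>e. 2 * (int k + int e) + 2 * int \<delta> - 1"
  let ?I = "{a \<in> {- int k..<int k} - {0}. w (int k) < w a}"
  have nondesc: "w (int i) < w (int i + 1)" if "i < k" "i \<notin> ?D" for i
    using that k hyperoct_inj[OF w, of "int i" "int i + 1"] by (auto simp: Des_def)
  have fin: "finite ?D" by simp
  show ?thesis
  proof (cases "?D = {}")
    case True
    \<comment> \<open>Without descents before \<open>k\<close>, \<open>w\<close> increases from
      \<open>w 0 = 0\<close>, so \<open>w k\<close> is positive and \<open>k\<close> contributes no
      inversions.\<close>
    have incr: "w (int a) < w (int b)" if "a < b" "b \<le> k" for a b
    proof (rule increasing_run[OF _ that(1)])
      fix i assume "i < b"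
      then show "w (int i) < w (int i + 1)"
        using nondesc[of i] that unfolding True by simp
    qed
    have pos: "0 < w (int k)"
      using incr[of 0 k] k hyperoct_0[OF w] by simp
    have "w a < w (int k)" if a: "a \<in> {- int k..<int k} - {0}" for a
    proof (cases "0 \<le> a")
      case True
      then show ?thesis using incr[of "nat a" k] a by (simp add: nat_less_iff)
    next
      case False
      then have "w 0 < w (- a)"
        using incr[of 0 "nat (- a)"] a by simp
      then show ?thesis
        using hyperoct_minus[OF w, of a] hyperoct_0[OF w] pos by simp
    qed
    then have "?I = {}" by force
    then show ?thesis
      using pos True unfolding invs_at_def by (simp only: True) simp
  next
    case False
    define e where "e = Max ?D"
    have e: "e \<in> ?D" unfolding e_def using fin False by (rule Max_in)
    have le_e: "a \<le> int e" if "a \<in> ?I" for a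
    proof (rule ccontr)
      assume "\<not> a \<le> int e"
      then have a: "e < nat a" "int (nat a) = a" by auto
      have "i \<notin> ?D" if "nat a \<le> i" for i
      proof
        assume "i \<in> ?D"
        then have "i \<le> e" unfolding e_def by (rule Max_ge[OF fin])
        then show False using that a by linarith
      qed
      then have "w (int (nat a)) < w (int k)"
        using \<open>a \<in> ?I\<close> a nondesc by (intro increasing_run) auto
      then show False using \<open>a \<in> ?I\<close> a by simp
    qed
    \<comment> \<open>The last descent \<open>e\<close> suffices. A negative letter has at most
      \<open>k + e\<close> inversions and adds \<open>2 * \<delta> - 1\<close>; a positive one
      excludes \<open>a = - k\<close>, leaving at most \<open>k + e - 1\<close>.\<close>
    have "?f e \<le> (\<Sum>e\<in>?D. ?f e)"
      using e fin k by (intro member_le_sum) auto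
    moreover have "2 * int (invs_at w k) + (2 * int \<delta> - 1) * (if w (int k) < 0 then 1 else 0) \<le> ?f e"
    proof (cases "w (int k) < 0")
      case True
      have "?I \<subseteq> {- int k..int e} - {0}" using le_e by auto
      then have "invs_at w k \<le> card ({- int k..int e} - {0})"
        unfolding invs_at_def by (intro card_mono) auto
      also have "\<dots> = k + e" by (simp add: card_Diff_singleton_if nat_diff_distrib')
      finally show ?thesis using True by simp
    next
      case False
      have "- int k \<notin> ?I"
        using False hyperoct_minus[OF w, of "int k"] by auto
      have "?I \<subseteq> {- int k + 1..int e} - {0}"
      proof
        fix a assume a: "a \<in> ?I"
        then have "a \<noteq> - int k" using \<open>- int k \<notin> ?I\<close> by metis
        then show "a \<in> {- int k + 1..int e} - {0}" using a le_e[OF a] by simp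
      qed
      then have "invs_at w k \<le> card ({- int k + 1..int e} - {0})"
        unfolding invs_at_def by (intro card_mono) auto
      also have "\<dots> = k + e - 1"
        using k by (simp add: card_Diff_singleton_if nat_diff_distrib')
      finally have "int (invs_at w k) + 1 \<le> int k + int e"
        using k by auto
      then show ?thesis using False by simp
    qed
    ultimately show ?thesis by simp
  qed
qed

lemma sum_letter_bound:
  "e \<le> n \<Longrightarrow> (\<Sum>k=Suc e..n. 2 * (int k + int e) + 2 * int \<delta> - 1) =
    (int n - int e) * (int n + 3 * int e + 2 * int \<delta>)"
  by (induction n rule: dec_induct) (auto simp: algebra_simps)

text \<open>The cost of each letter is charged to the descents before it. After exchanging the sums,
  the total charge of a descent \<open>e\<close> is at most
  \<open>desc_wt n \<delta> e\<close>.\<close>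

lemma X_exponent_nonneg:
  assumes w: "w \<in> hyperoct n" and \<delta>: "\<delta> \<in> {0, 1}"
  shows "X_exponent n \<delta> w \<ge> 0"
proof -
  let ?f = "\<lambda>e k. 2 * (int k + int e) + 2 * int \<delta> - 1"
  have fin: "finite (Des n w)" by (simp add: Des_def)
  have "int (neg n w) = (\<Sum>k=1..n. if w (int k) < 0 then 1 else 0)"
    by (simp add: neg_def sum.If_cases Int_def conj_commute)
  then have "2 * int (invs n w) + (2 * int \<delta> - 1) * int (neg n w) =
      (\<Sum>k=1..n. 2 * int (invs_at w k) + (2 * int \<delta> - 1) * (if w (int k) < 0 then 1 else 0))"
    by (simp only: invs_def of_nat_sum sum_distrib_left sum.distrib)
  also have "\<dots> \<le> (\<Sum>k=1..n. \<Sum>e | e \<in> Des n w \<and> e < k. ?f e k)"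
    by (intro sum_mono letter_exponent_le[OF w])
  also have "\<dots> = (\<Sum>e\<in>Des n w. \<Sum>k | k \<in> {1..n} \<and> e < k. ?f e k)"
    by (rule sum.swap_restrict) (simp_all add: fin)
  also have "\<dots> \<le> (\<Sum>e\<in>Des n w. desc_wt n \<delta> e)"
  proof (rule sum_mono)
    fix e assume "e \<in> Des n w"
    then have e: "e < n" by (simp add: Des_def)
    have "{k. k \<in> {1..n} \<and> e < k} = {Suc e..n}" by auto
    then have "(\<Sum>k | k \<in> {1..n} \<and> e < k. ?f e k) =
        (int n - int e) * (int n + 3 * int e + 2 * int \<delta>)"
      using sum_letter_bound[of e n \<delta>] e by simp
    \<comment> \<open>The difference of the two sides is
      \<open>m * (m + 1) + 2 * e + \<delta>\<close>.\<close>
    moreover obtain m where m: "n = Suc (e + m)"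
      using less_imp_Suc_add[OF e] by blast
    ultimately show "(\<Sum>k | k \<in> {1..n} \<and> e < k. ?f e k) \<le> desc_wt n \<delta> e"
      using \<delta> by (auto simp: desc_wt_def m power2_eq_square algebra_simps)
  qed
  finally show ?thesis
    by (simp add: X_exponent_eq[OF w])
qed

section \<open>Evaluation at rational points\<close>

text \<open>For fixed \<open>z\<close> the difference vanishes at infinitely many \<open>x\<close>,
  so it is zero in \<open>Q[X]\<close>; then \<open>f - g\<close> has the infinitely many roots
  \<open>[:z:]\<close>.\<close>

lemma poly_poly_eqI:
  fixes f g :: "rat poly poly"
  assumes eq: "\<And>x z. x > 1 \<Longrightarrow> z > 1 \<Longrightarrow> poly (poly f [:z:]) x = poly (poly g [:z:]) x"
  shows "f = g"
proof (rule ccontr)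
  assume "f \<noteq> g"
  then have fin: "finite {r. poly (f - g) r = 0}"
    by (intro poly_roots_finite) simp
  have "poly (f - g) [:z:] = 0" if "z > 1" for z
  proof (rule ccontr)
    assume "poly (f - g) [:z:] \<noteq> 0"
    then have "finite {x. poly (poly (f - g) [:z:]) x = 0}"
      by (rule poly_roots_finite)
    moreover have "{1<..} \<subseteq> {x. poly (poly (f - g) [:z:]) x = 0}"
      using eq that by auto
    ultimately have "finite {1 :: rat<..}"
      by (rule finite_subset[rotated])
    then show False
      by (simp add: infinite_Ioi)
  qed
  then have "(\<lambda>z. [:z:]) ` {1<..} \<subseteq> {r. poly (f - g) r = 0}"
    by auto
  then have "finite ((\<lambda>z::rat. [:z:]) ` {1<..})"
    using fin by (rule finite_subset)
  then have "finite {1 :: rat<..}"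
    by (rule finite_imageD) (simp add: inj_on_def)
  then show False
    by (simp add: infinite_Ioi)
qed

lemma power_int_sum:
  "x \<noteq> 0 \<Longrightarrow> (\<Prod>i\<in>A. x powi f i) = (x :: 'a::field) powi (\<Sum>i\<in>A. f i)"
  by (induction A rule: infinite_finite_induct) (simp_all add: power_int_add)

lemma power_int_linear:
  "x \<noteq> 0 \<Longrightarrow> (x :: 'a::field) powi (a + b * int i + d * int j) = x powi a * (x powi b) ^ i * (x powi d) ^ j"
  by (simp add: power_int_add power_int_mult)

lemma two_times_choose_two: "2 * int (m choose 2) = int m * (int m - 1)"
  by (induction m) (simp_all add: choose_two_Suc algebra_simps)

lemma desc_wt_choose:
  assumes "\<delta> \<in> {0, 1}"
  shows "desc_wt n \<delta> i =
    int ((2 * n + \<delta>) choose 2) - int ((2 * i + \<delta>) choose 2) + 2 * int i + int \<delta>"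
proof -
  have "2 * desc_wt n \<delta> i = 2 * int ((2 * n + \<delta>) choose 2) - 2 * int ((2 * i + \<delta>) choose 2) +
      4 * int i + 2 * int \<delta>"
    unfolding two_times_choose_two using assms
    by (auto simp: desc_wt_def power2_eq_square algebra_simps)
  then show ?thesis by simp
qed

text \<open>This gives the descent weights the form \<open>y * c ^ i * p ^ (i * (i - 1))\<close>
  that \<open>gf_product\<close> requires.\<close>

lemma desc_wt_shift:
  "desc_wt n \<delta> i = desc_wt n \<delta> 0 + (1 - 2 * int \<delta>) * int i + (- 2) * int (i * (i - 1))"
  by (cases i) (simp_all add: desc_wt_def power2_eq_square algebra_simps)

lemma signed_gf_eval:
  fixes x z :: rat
  assumes n: "n \<ge> 1" and \<delta>: "\<delta> \<in> {0, 1}" and x: "x > 1" and z: "z > 1"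
  shows "(\<Sum>w\<in>hyperoct n. (- 1) ^ neg n w * x ^ nat (X_exponent n \<delta> w) * z ^ des n w) =
    (1 - x ^ ((2 * n + \<delta> - 1) choose 2) * z) *
    (\<Prod>i=2..n. 1 - x ^ (((2 * n + \<delta>) choose 2) - ((2 * i + \<delta>) choose 2) + 2 * i + \<delta>) * z)"
proof -
  define p c y where "p = x powi (- 2)" and "c = x powi (1 - 2 * int \<delta>)"
    and "y = z * x powi (desc_wt n \<delta> 0)"
  let ?y = "\<lambda>i. y * c ^ i * p ^ (i * (i - 1))"
  have x0: "x \<noteq> 0" using x by simp
  have y_eq: "?y i = z * x powi (desc_wt n \<delta> i)" for i
    unfolding desc_wt_shift[of n \<delta> i] p_def c_def y_def power_int_linear[OF x0]
    by (simp only: mult.assoc)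
  have pow_nat: "x ^ k = x powi int k" for k
    by (simp add: power_int_of_nat)
  \<comment> \<open>Used to cancel \<open>(1 - ?y 0) * (1 - ?y 1)\<close> at the end.\<close>
  have y_gt: "?y i > 1" if "i < 2" "i \<le> n" for i
  proof -
    obtain m where "n = Suc m"
      using n by (cases n) auto
    then have "0 \<le> desc_wt n \<delta> i"
      using \<delta> less_2_cases[OF that(1)]
      by (auto simp: desc_wt_def power2_eq_square algebra_simps)
    then have "1 \<le> x powi desc_wt n \<delta> i"
      using x by (simp add: power_int_def)
    then have "z * 1 \<le> z * x powi desc_wt n \<delta> i"
      using z by (intro mult_left_mono) auto
    then show ?thesis unfolding y_eq using z by linarith
  qed
  have p1: "p ^ i \<noteq> 1" if "0 < i" for i
  proof -
    have "1 < x ^ (2 * i)" using x that by (intro one_less_power) auto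
    moreover have "p ^ i = inverse (x ^ (2 * i))"
      by (simp add: p_def power_int_minus power_mult power_inverse)
    ultimately show ?thesis
      using inverse_eq_1_iff[of "x ^ (2 * i)"] by linarith
  qed
  have "(\<Sum>w\<in>hyperoct n. (- 1) ^ neg n w * x ^ nat (X_exponent n \<delta> w) * z ^ des n w) =
      gf p (- c) ?y n (\<lambda>_. 1)"
    unfolding gf_def
  proof (rule sum.cong[OF refl])
    fix w assume w: "w \<in> hyperoct n"
    have exponent: "X_exponent n \<delta> w = (\<Sum>i\<in>Des n w. desc_wt n \<delta> i) + (- 2) * int (invs n w) +
        (1 - 2 * int \<delta>) * int (neg n w)"
      unfolding X_exponent_eq[OF w] by (simp add: algebra_simps)
    have "x ^ nat (X_exponent n \<delta> w) = x powi X_exponent n \<delta> w"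
      using X_exponent_nonneg[OF w \<delta>] by (simp add: power_int_def)
    also have "\<dots> = (\<Prod>i\<in>Des n w. x powi desc_wt n \<delta> i) * p ^ invs n w * c ^ neg n w"
      unfolding exponent p_def c_def power_int_linear[OF x0] power_int_sum[OF x0] ..
    finally show "(- 1) ^ neg n w * x ^ nat (X_exponent n \<delta> w) * z ^ des n w =
        (- c) ^ neg n w * p ^ invs n w * (\<Prod>i\<in>Des n w. ?y i) * 1"
      unfolding y_eq prod.distrib power_minus[of c] by (simp add: des_def mult_ac)
  qed
  also have "\<dots> = (1 - y * c * p ^ n) * (\<Prod>i=2..n. 1 - ?y i)"
  proof -
    have "{..n} = {0, 1} \<union> {2..n}" using n by auto
    then have "(\<Prod>i\<le>n. 1 - ?y i) = (1 - ?y 0) * (1 - ?y 1) * (\<Prod>i=2..n. 1 - ?y i)"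
      by (simp add: mult.assoc)
    then have "(1 - ?y 0) * (1 - ?y 1) * gf p (- c) ?y n (\<lambda>_. 1) =
        (1 - ?y 0) * (1 - ?y 1) * ((1 - y * c * p ^ n) * (\<Prod>i=2..n. 1 - ?y i))"
      using gf_product[of p y c n, OF p1] by (simp only: mult_ac)
    moreover have "(1 - ?y 0) * (1 - ?y 1) \<noteq> 0"
      using y_gt[of 0] y_gt[of 1] n by simp
    ultimately show ?thesis
      by (simp only: mult_cancel_left) simp
  qed
  also have "y * c * p ^ n = x ^ ((2 * n + \<delta> - 1) choose 2) * z"
  proof -
    have "2 * (desc_wt n \<delta> 0 + (1 - 2 * int \<delta>) + (- 2) * int n) = 2 * int ((2 * n + \<delta> - 1) choose 2)"
      unfolding two_times_choose_two using \<delta> n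
      by (auto simp: desc_wt_def power2_eq_square algebra_simps of_nat_diff)
    then have "desc_wt n \<delta> 0 + (1 - 2 * int \<delta>) + (- 2) * int n = int ((2 * n + \<delta> - 1) choose 2)"
      by simp
    moreover have "y * c * p ^ n = z * x powi (desc_wt n \<delta> 0 + (1 - 2 * int \<delta>) + (- 2) * int n)"
      using power_int_linear[OF x0, of "desc_wt n \<delta> 0" "1 - 2 * int \<delta>" 1 "- 2" n]
      unfolding p_def c_def y_def by (simp add: mult.assoc)
    ultimately show ?thesis by (simp only: pow_nat mult.commute[of z])
  qed
  also have "(\<Prod>i=2..n. 1 - ?y i) =
      (\<Prod>i=2..n. 1 - x ^ (((2 * n + \<delta>) choose 2) - ((2 * i + \<delta>) choose 2) + 2 * i + \<delta>) * z)"
  proof (rule prod.cong[OF refl])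
    fix i assume "i \<in> {2..n}"
    \<comment> \<open>Hence the subtraction of natural numbers in the exponent does not
      truncate.\<close>
    then have "(2 * i + \<delta>) choose 2 \<le> (2 * n + \<delta>) choose 2"
      by (intro binomial_right_mono) auto
    then have "desc_wt n \<delta> i = int (((2 * n + \<delta>) choose 2) - ((2 * i + \<delta>) choose 2) + 2 * i + \<delta>)"
      unfolding desc_wt_choose[OF \<delta>] by simp
    then show "1 - ?y i =
        1 - x ^ (((2 * n + \<delta>) choose 2) - ((2 * i + \<delta>) choose 2) + 2 * i + \<delta>) * z"
      unfolding y_eq by (simp only: pow_nat mult.commute[of z])
  qed
  finally show ?thesis .
qed

text \<open>The first conjunct ensures that \<open>nat\<close> does not alter the exponents in the
  second. For \<open>n = 0\<close> the left side would be 1, but the right side would not.\<close>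

theorem proposition5p5:
  fixes n \<delta> :: nat
  assumes "n \<ge> 1" and "\<delta> \<in> {0, 1}"
  shows "(\<forall>w \<in> hyperoct n. X_exponent n \<delta> w \<ge> 0) \<and>
    (\<Sum>w\<in>hyperoct n. (- 1) ^ neg n w * X ^ nat (X_exponent n \<delta> w) * Z ^ des n w) =
    (1 - X ^ ((2 * n + \<delta> - 1) choose 2) * Z) *
    (\<Prod>i=2..n. 1 - X ^ (((2 * n + \<delta>) choose 2) - ((2 * i + \<delta>) choose 2) + 2 * i + \<delta>) * Z)"
proof (intro conjI ballI poly_poly_eqI)
  show "X_exponent n \<delta> w \<ge> 0" if "w \<in> hyperoct n" for w
    using that assms(2) by (rule X_exponent_nonneg)
  fix x z :: rat
  assume "x > 1" "z > 1"
  then show "poly (poly (\<Sum>w\<in>hyperoct n. (- 1) ^ neg n w * X ^ nat (X_exponent n \<delta> w) * Z ^ des n w)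
        [:z:]) x =
      poly (poly ((1 - X ^ ((2 * n + \<delta> - 1) choose 2) * Z) *
        (\<Prod>i=2..n. 1 - X ^ (((2 * n + \<delta>) choose 2) - ((2 * i + \<delta>) choose 2) + 2 * i + \<delta>) * Z))
        [:z:]) x"
    using signed_gf_eval[OF assms, of x z] by (simp add: poly_sum poly_prod mult.commute)
qed

end
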